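(* Let $n\ge1$ and let $\mathbb{S}=\{\mathcal{S}_i\}_{i\in\{1,\dots,n\}}$ be a finite collection of finite non-empty sets $\mathcal{S}_i\subset\mathbb{R}$, with maximum stepsize $\Delta_{\mathbb{S}}$. Let $(i_k)_{k\ge1}$ be any sequence with $i_k\in\{1,\dots,n\}$, and let $P^{\mathrm{req}}_k\in\mathrm{conv}(\mathcal{S}_{i_k})$ for every $k\ge1$. Let $e^P_k:=\sum_{j=1}^k(P^{\mathrm{imp}}_j-P^{\mathrm{req}}_j)$ for $k\ge0$ (so $e^P_0=0$). If a resource agent implements $$P^{\mathrm{imp}}_k=\mathrm{proj}_{\mathcal{S}_{i_k}}\bigl(P^{\mathrm{req}}_k-e^P_{k-1}\bigr)\quad\text{for every }k\ge1,$$ then it has $\tfrac12\Delta_{\mathbb{S}}$-bounded accumulated-error, i.e. $|e^P_k|\le\tfrac12\Delta_{\mathbb{S}}$ for every $k\ge1$.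
   Context: The resource only produces/consumes real power, so setpoints are real numbers $P$ (reactive components are identically $0$). For a finite non-empty set $\mathcal{S}\subset\mathbb{R}$ with elements $s_1<\dots<s_{|\mathcal{S}|}$, the maximum stepsize is $\Delta_{\mathcal{S}}:=0$ if $|\mathcal{S}|=1$ and $\Delta_{\mathcal{S}}:=\max_{1\le i\le|\mathcal{S}|-1}(s_{i+1}-s_i)$ otherwise. For a collection, $\Delta_{\mathbb{S}}:=\max_{i}\Delta_{\mathcal{S}_i}$. $\mathrm{proj}_{\mathcal{S}}$ is any projection operator onto $\mathcal{S}$: a map sending $x$ to some point of $\mathcal{S}$ closest to $x$ (ties broken arbitrarily). *)

theory Defs
  imports "HOL-Analysis.Analysis"
begin

text \<open>
  For a finite non-empty set with elements s_1 < ... < s_m, the list \<open>sorted_list_of_set S\<close>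
  enumerates the elements with indices shifted by one, so the steps s_(i+1) - s_i,
  1 <= i <= m - 1, are the differences at list positions below m - 1.
  The value is meaningful only for finite non-empty sets.
\<close>

definition max_stepsize :: "real set \<Rightarrow> real" where
  "max_stepsize S =
     (if card S = 1 then 0
      else Max ((\<lambda>i. sorted_list_of_set S ! Suc i - sorted_list_of_set S ! i) ` {..<card S - 1}))"

definition collection_stepsize :: "nat \<Rightarrow> (nat \<Rightarrow> real set) \<Rightarrow> real" where
  "collection_stepsize n S = Max ((\<lambda>i. max_stepsize (S i)) ` {1..n})"

text \<open>
  Closest points need not be unique; any choice among them is admitted.
\<close>

definition is_projection_onto :: "real set \<Rightarrow> (real \<Rightarrow> real) \<Rightarrow> bool" where
  "is_projection_onto S p \<longleftrightarrow> (\<forall>x. p x \<in> S \<and> (\<forall>s\<in>S. dist x (p x) \<le> dist x s))"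

text \<open>
  Time starts at 1: the values of the sequences at 0 are never used, and the error at time 0 is 0.
\<close>

definition accumulated_error :: "(nat \<Rightarrow> real) \<Rightarrow> (nat \<Rightarrow> real) \<Rightarrow> nat \<Rightarrow> real" where
  "accumulated_error Pimp Preq k = (\<Sum>j=1..k. Pimp j - Preq j)"

definition bounded_accumulated_error :: "real \<Rightarrow> (nat \<Rightarrow> real) \<Rightarrow> (nat \<Rightarrow> real) \<Rightarrow> bool" where
  "bounded_accumulated_error c Pimp Preq \<longleftrightarrow> (\<forall>k\<ge>1. \<bar>accumulated_error Pimp Preq k\<bar> \<le> c)"

end

theory Submission
  imports Defs
begin

text \<open>
  Write e(k) for the accumulated error and x(k) = Preq(k) - e(k-1) for the point that is projected.
  Then e(k) = proj x(k) - x(k), so the absolute error is the distance of x(k) from the current set.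
  Inductively x(k) is within half a step of Preq(k): if it lies between the extreme points of the
  set, it lies in a gap of at most one step, and otherwise the nearest extreme point is no farther
  from x(k) than Preq(k) is.
\<close>

lemma stepsize_ge_diff:
  fixes S :: "real set"
  assumes "Suc i < card S"
  shows "sorted_list_of_set S ! Suc i - sorted_list_of_set S ! i \<le> max_stepsize S"
  using assms unfolding max_stepsize_def by (auto intro!: Max_ge)

lemma max_stepsize_nonneg:
  assumes "finite S" "S \<noteq> {}"
  shows "0 \<le> max_stepsize S"
proof (cases "card S = 1")
  case True
  then show ?thesis by (simp add: max_stepsize_def)
next
  case False
  moreover have "card S \<noteq> 0" using assms by simp
  ultimately have c: "Suc 0 < card S" by linarith
  have "sorted_list_of_set S ! 0 \<le> sorted_list_of_set S ! Suc 0"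
    using c by (intro sorted_nth_mono) auto
  with stepsize_ge_diff[OF c] show ?thesis by linarith
qed

text \<open>The hypotheses make \<open>a\<close> and \<open>b\<close> neighbours in
  \<open>S\<close>, so the entry listed right after \<open>a\<close> is at least \<open>b\<close>,
  and \<open>b - a\<close> is bounded by a single listed step.\<close>

lemma gap_le_max_stepsize:
  assumes "finite S" "a \<in> S" "b \<in> S" "a < b" and gap: "\<And>s. s \<in> S \<Longrightarrow> s \<le> a \<or> b \<le> s"
  shows "b - a \<le> max_stepsize S"
proof -
  let ?l = "sorted_list_of_set S"
  have set: "set ?l = S" and len: "length ?l = card S"
    using assms(1) by auto
  obtain i where i: "i < card S" "?l ! i = a"
    using assms(2) set len by (metis in_set_conv_nth)
  obtain j where j: "j < card S" "?l ! j = b"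
    using assms(3) set len by (metis in_set_conv_nth)
  have "i < j"
  proof (rule ccontr)
    assume "\<not> i < j"
    then have "?l ! j \<le> ?l ! i" using i len by (intro sorted_nth_mono) auto
    with i j assms(4) show False by simp
  qed
  then have si: "Suc i < card S" using j by simp
  \<comment> \<open>Strictness rules out the alternative \<open>s \<le> a\<close> of
    \<open>gap\<close> for this entry.\<close>
  have "?l ! i < ?l ! Suc i"
    using sorted_wrt_nth_less[OF strict_sorted_list_of_set, of i "Suc i" S] si len by simp
  moreover have "?l ! Suc i \<in> S" using si set len by (metis nth_mem)
  ultimately have "b \<le> ?l ! Suc i" using gap i by fastforce
  with stepsize_ge_diff[OF si] i show ?thesis by linarith
qed

text \<open>The points \<open>a\<close> and \<open>b\<close> guarantee that \<open>x\<close> has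
  neighbours in \<open>S\<close> on both sides; the nearer neighbour is at most half of their gap
  away.\<close>

lemma near_point_between:
  assumes "finite S" "a \<in> S" "a \<le> x" "b \<in> S" "x \<le> b"
  shows "\<exists>s\<in>S. \<bar>x - s\<bar> \<le> 1/2 * max_stepsize S"
proof -
  let ?A = "{s\<in>S. s \<le> x}" and ?B = "{s\<in>S. x \<le> s}"
  define p where "p = Max ?A"
  define q where "q = Min ?B"
  have p: "p \<in> ?A" unfolding p_def using assms by (intro Max_in) auto
  have q: "q \<in> ?B" unfolding q_def using assms by (intro Min_in) auto
  have gap: "s \<le> p \<or> q \<le> s" if "s \<in> S" for s
    using that assms(1) unfolding p_def q_def by (cases "s \<le> x") auto
  have "0 \<le> max_stepsize S" using assms by (intro max_stepsize_nonneg) auto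
  \<comment> \<open>If \<open>p < q\<close> fails, then \<open>p = x = q\<close> and nonnegativity
    of the stepsize suffices.\<close>
  then have "q - p \<le> max_stepsize S"
    using gap_le_max_stepsize[OF assms(1), of p q] p q gap by (cases "p < q") auto
  then have "\<bar>x - p\<bar> \<le> 1/2 * max_stepsize S \<or> \<bar>x - q\<bar> \<le> 1/2 * max_stepsize S"
    using p q by auto
  then show ?thesis using p q by blast
qed

text \<open>The bound is a free \<open>D\<close>, not the stepsize of \<open>S\<close>, because the
  offset of \<open>x\<close> from \<open>y\<close> may stem from earlier sets with larger
  steps.\<close>

lemma near_point_convex_hull:
  assumes "finite S" "S \<noteq> {}" "max_stepsize S \<le> D"
    and y: "y \<in> convex hull S" and xy: "\<bar>x - y\<bar> \<le> 1/2 * D"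
  shows "\<exists>s\<in>S. \<bar>x - s\<bar> \<le> 1/2 * D"
proof -
  have mem: "Min S \<in> S" "Max S \<in> S" using assms by auto
  have "convex hull S \<subseteq> {Min S..Max S}"
    using assms(1) by (intro hull_minimal) auto
  with y have "Min S \<le> y" "y \<le> Max S" by auto
  \<comment> \<open>If \<open>x < Min S\<close>, then \<open>Min S\<close> lies between
    \<open>x\<close> and \<open>y\<close>, hence within the distance from \<open>x\<close> to
    \<open>y\<close>; likewise for \<open>Max S\<close>.\<close>
  then consider "\<bar>x - Min S\<bar> \<le> 1/2 * D" | "\<bar>x - Max S\<bar> \<le> 1/2 * D" | "Min S \<le> x" "x \<le> Max S"
    using xy by linarith
  then show ?thesis
  proof cases
    case 3
    then obtain s where "s \<in> S" "\<bar>x - s\<bar> \<le> 1/2 * max_stepsize S"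
      using near_point_between[OF assms(1) mem(1) _ mem(2)] by blast
    with assms(3) show ?thesis by force
  qed (use mem in auto)
qed

theorem theorem2:
  fixes n :: nat
    and S :: "nat \<Rightarrow> real set"
    and idx :: "nat \<Rightarrow> nat"
    and proj :: "real set \<Rightarrow> real \<Rightarrow> real"
    and Preq Pimp :: "nat \<Rightarrow> real"
  assumes "n \<ge> 1"
    and "\<And>i. i \<in> {1..n} \<Longrightarrow> finite (S i) \<and> S i \<noteq> {}"
    and "\<And>i. i \<in> {1..n} \<Longrightarrow> is_projection_onto (S i) (proj (S i))"
    and "\<And>k. k \<ge> 1 \<Longrightarrow> idx k \<in> {1..n}"
    and "\<And>k. k \<ge> 1 \<Longrightarrow> Preq k \<in> convex hull (S (idx k))"
    and "\<And>k. k \<ge> 1 \<Longrightarrow>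
           Pimp k = proj (S (idx k)) (Preq k - accumulated_error Pimp Preq (k - 1))"
  shows "bounded_accumulated_error (1/2 * collection_stepsize n S) Pimp Preq"
proof -
  let ?D = "collection_stepsize n S" and ?e = "accumulated_error Pimp Preq"
  have le: "max_stepsize (S i) \<le> ?D" if "i \<in> {1..n}" for i
    unfolding collection_stepsize_def using that by (intro Max_ge) auto
  \<comment> \<open>Starting at 0 lets the first projection be an ordinary induction step; the base
    case says only that \<open>?D\<close> is nonnegative.\<close>
  have "\<bar>?e k\<bar> \<le> 1/2 * ?D" for k
  proof (induction k)
    case 0
    have "0 \<le> max_stepsize (S 1)" using assms(1,2) by (intro max_stepsize_nonneg) auto
    also have "\<dots> \<le> ?D" using assms(1) by (intro le) auto
    finally show ?case by (simp add: accumulated_error_def)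
  next
    case (Suc k)
    let ?T = "S (idx (Suc k))" and ?x = "Preq (Suc k) - ?e k"
    have i: "idx (Suc k) \<in> {1..n}" by (rule assms(4)) simp
    \<comment> \<open>The offset of \<open>?x\<close> from the request is the previous error, which
      the induction hypothesis bounds.\<close>
    obtain s where s: "s \<in> ?T" "\<bar>?x - s\<bar> \<le> 1/2 * ?D"
      using near_point_convex_hull[of ?T ?D "Preq (Suc k)" ?x] assms(2)[OF i] le[OF i]
        assms(5)[of "Suc k"] Suc.IH by auto
    have imp: "Pimp (Suc k) = proj ?T ?x"
      using assms(6)[of "Suc k"] by simp
    have "?e (Suc k) = Pimp (Suc k) - ?x"
      by (simp add: accumulated_error_def)
    then have "\<bar>?e (Suc k)\<bar> = dist ?x (proj ?T ?x)"
      using imp by (simp add: dist_real_def)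
    \<comment> \<open>The projection may differ from \<open>s\<close>, but it is no farther from
      \<open>?x\<close>, however ties are broken.\<close>
    also have "\<dots> \<le> dist ?x s"
      using assms(3)[OF i] s(1) unfolding is_projection_onto_def by blast
    also have "\<dots> \<le> 1/2 * ?D" using s(2) by (simp add: dist_real_def)
    finally show ?case .
  qed
  then show ?thesis by (simp add: bounded_accumulated_error_def)
qed

end
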